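(* Let $G$ be a graph on $n$ vertices such that $P(G,m)-P_{DP}(G,m)=O(m^{n-3})$ as $m\to\infty$. Then there exist $p,N\in\mathbb{N}$ such that $P_{DP}(G\vee K_p,m)=P(G\vee K_p,m)$ for every integer $m\geq N$.
   Context: All graphs are finite and simple. $G\vee K_p$ is the join of $G$ with the complete graph $K_p$. $P(G,m)$ denotes the chromatic polynomial of $G$. A cover of a graph $G$ is a pair $\mathcal{H}=(L,H)$ where $H$ is a graph and $L:V(G)\to\mathcal{P}(V(H))$ satisfies: (1) the sets $L(u)$, $u\in V(G)$, partition $V(H)$; (2) for every $u$, $H[L(u)]$ is complete; (3) if $E_H(L(u),L(v))\neq\emptyset$ then $u=v$ or $uv\in E(G)$; (4) if $uv\in E(G)$ then $E_H(L(u),L(v))$ is a matching (possibly empty). Here $E_H(S,U)$ is the set of edges of $H$ between $S$ and $U$. The cover is $m$-fold if $|L(u)|=m$ for all $u$. An $\mathcal{H}$-coloring is an independent set of $H$ of size $|V(G)|$. $P_{DP}(G,\mathcal{H})$ is the number of $\mathcal{H}$-colorings, and $P_{DP}(G,m)$ is the minimum of $P_{DP}(G,\mathcal{H})$ over all $m$-fold covers $\mathcal{H}$ of $G$. *)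

theory Defs
  imports Complex_Main "HOL-Library.FuncSet" "HOL-Library.Landau_Symbols"
begin

definition simple_graph :: "'a set \<Rightarrow> 'a set set \<Rightarrow> bool" where
  "simple_graph V E \<longleftrightarrow> finite V \<and> (\<forall>e\<in>E. \<exists>u v. e = {u, v} \<and> u \<in> V \<and> v \<in> V \<and> u \<noteq> v)"

definition chrom :: "'a set \<Rightarrow> 'a set set \<Rightarrow> nat \<Rightarrow> nat" where
  "chrom V E m = card {f \<in> V \<rightarrow>\<^sub>E {0..<m}. \<forall>u\<in>V. \<forall>v\<in>V. {u, v} \<in> E \<longrightarrow> f u \<noteq> f v}"

definition edges_between :: "'b set set \<Rightarrow> 'b set \<Rightarrow> 'b set \<Rightarrow> 'b set set" where
  "edges_between HE S U = {e \<in> HE. \<exists>x\<in>S. \<exists>y\<in>U. e = {x, y}}"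

definition is_cover :: "'a set \<Rightarrow> 'a set set \<Rightarrow> ('a \<Rightarrow> 'b set) \<Rightarrow> 'b set \<Rightarrow> 'b set set \<Rightarrow> bool" where
  "is_cover V E L HV HE \<longleftrightarrow>
     simple_graph HV HE \<and>
     (\<Union>u\<in>V. L u) = HV \<and>
     (\<forall>u\<in>V. \<forall>v\<in>V. u \<noteq> v \<longrightarrow> L u \<inter> L v = {}) \<and>
     (\<forall>u\<in>V. \<forall>x\<in>L u. \<forall>y\<in>L u. x \<noteq> y \<longrightarrow> {x, y} \<in> HE) \<and>
     (\<forall>u\<in>V. \<forall>v\<in>V. edges_between HE (L u) (L v) \<noteq> {} \<longrightarrow> u = v \<or> {u, v} \<in> E) \<and>
     (\<forall>u\<in>V. \<forall>v\<in>V. {u, v} \<in> E \<longrightarrow>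
        (\<forall>e1\<in>edges_between HE (L u) (L v). \<forall>e2\<in>edges_between HE (L u) (L v).
            e1 \<noteq> e2 \<longrightarrow> e1 \<inter> e2 = {}))"

definition is_mfold_cover :: "'a set \<Rightarrow> 'a set set \<Rightarrow> nat \<Rightarrow> ('a \<Rightarrow> 'b set) \<Rightarrow> 'b set \<Rightarrow> 'b set set \<Rightarrow> bool" where
  "is_mfold_cover V E m L HV HE \<longleftrightarrow> is_cover V E L HV HE \<and> (\<forall>u\<in>V. finite (L u) \<and> card (L u) = m)"

definition dp_count :: "'a set \<Rightarrow> 'b set \<Rightarrow> 'b set set \<Rightarrow> nat" where
  "dp_count V HV HE = card {I. I \<subseteq> HV \<and> card I = card V \<and> (\<forall>x\<in>I. \<forall>y\<in>I. {x, y} \<notin> HE)}"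

text \<open>DP colour function: minimum over all m-fold covers. Every cover is isomorphic to one whose
  cover graph has vertices in 'a \<times> nat, so we take covers of that vertex type.\<close>
definition dp_chrom :: "'a set \<Rightarrow> 'a set set \<Rightarrow> nat \<Rightarrow> nat" where
  "dp_chrom V E m = Inf {dp_count V HV HE | (L :: 'a \<Rightarrow> ('a \<times> nat) set) HV HE.
                          is_mfold_cover V E m L HV HE}"

definition join_K_V :: "'a set \<Rightarrow> nat \<Rightarrow> ('a + nat) set" where
  "join_K_V V p = Inl ` V \<union> Inr ` {0..<p}"

definition join_K_E :: "'a set \<Rightarrow> 'a set set \<Rightarrow> nat \<Rightarrow> ('a + nat) set set" where
  "join_K_E V E p = (\<lambda>e. Inl ` e) ` E
     \<union> {{Inr i, Inr j} | i j. i < p \<and> j < p \<and> i \<noteq> j}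
     \<union> {{Inl v, Inr i} | v i. v \<in> V \<and> i < p}"

end

theory Submission
  imports Defs
begin

text \<open>
  Let \<open>C\<close> be such that \<open>P(G,m) - P_DP(G,m) \<le> C m^(n-3)\<close> for large \<open>m\<close>. Adding one vertex \<open>w\<close> joined to
  all of \<open>G\<close> lowers the constant by at least \<open>1/2\<close>, so \<open>p \<ge> 2C\<close> such steps leave no deficit. Indeed, given
  an \<open>m\<close>-fold cover of the cone over \<open>G\<close>, colouring \<open>w\<close> by \<open>c\<close> leaves an \<open>(m-1)\<close>-fold cover of \<open>G\<close>, whence
  at least \<open>m P_DP(G,m-1)\<close> colourings in all. Identify every list with that of \<open>w\<close> along the matchings
  at \<open>w\<close>. If all matchings inside \<open>G\<close> become part of the identity, there are at least
  \<open>P(cone,m)\<close> colourings. Otherwise some matching over an edge of \<open>G\<close> moves a colour \<open>c\<close>; once \<open>w\<close> receives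
  \<open>c\<close>, this matching is no longer perfect in the remaining cover, and adding a further edge to it destroys
  about \<open>m^(n-2)\<close> colourings. These are gained over \<open>m P_DP(G,m-1)\<close>.
\<close>

section \<open>Covers as conflict relations\<close>

text \<open>Covers are represented by the lists together with conflict relations between them: \<open>R u v c d\<close> says
  that colour \<open>c\<close> of \<open>u\<close> is joined to colour \<open>d\<close> of \<open>v\<close>. Only pairs \<open>u, v\<close> adjacent in the graph matter.\<close>

definition matching_cover ::
  "'v set \<Rightarrow> 'v set set \<Rightarrow> nat \<Rightarrow> ('v \<Rightarrow> 'c set) \<Rightarrow> ('v \<Rightarrow> 'v \<Rightarrow> 'c \<Rightarrow> 'c \<Rightarrow> bool) \<Rightarrow> bool" where
  "matching_cover V E m L R \<longleftrightarrow>
     (\<forall>u\<in>V. finite (L u) \<and> card (L u) = m) \<and>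
     (\<forall>u\<in>V. \<forall>v\<in>V. {u, v} \<in> E \<longrightarrow> (\<forall>c\<in>L u. \<forall>d\<in>L v. R u v c d \<longrightarrow> R v u d c)) \<and>
     (\<forall>u\<in>V. \<forall>v\<in>V. {u, v} \<in> E \<longrightarrow>
        (\<forall>c\<in>L u. \<forall>d\<in>L v. \<forall>d'\<in>L v. R u v c d \<longrightarrow> R u v c d' \<longrightarrow> d = d'))"

text \<open>Functions take the place of independent sets because lists of different vertices may
  overlap, as they do when all lists are \<open>{0..<m}\<close> and the conflict is equality, the
  case of ordinary proper colourings.\<close>

definition colorings ::
  "'v set \<Rightarrow> 'v set set \<Rightarrow> ('v \<Rightarrow> 'c set) \<Rightarrow> ('v \<Rightarrow> 'v \<Rightarrow> 'c \<Rightarrow> 'c \<Rightarrow> bool) \<Rightarrow> ('v \<Rightarrow> 'c) set" where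
  "colorings V E L R =
     {f \<in> PiE V L. \<forall>u\<in>V. \<forall>v\<in>V. {u, v} \<in> E \<longrightarrow> \<not> R u v (f u) (f v)}"

lemma chrom_eq_card_colorings:
  "chrom V E m = card (colorings V E (\<lambda>_. {0..<m}) (\<lambda>_ _. (=)))"
  by (simp add: chrom_def colorings_def)

lemma matching_coverD:
  assumes "matching_cover V E m L R" "u \<in> V"
  shows "finite (L u)" "card (L u) = m"
    and "v \<in> V \<Longrightarrow> {u, v} \<in> E \<Longrightarrow> c \<in> L u \<Longrightarrow> d \<in> L v \<Longrightarrow> R u v c d \<Longrightarrow> R v u d c"
    and "v \<in> V \<Longrightarrow> {u, v} \<in> E \<Longrightarrow> c \<in> L u \<Longrightarrow> d \<in> L v \<Longrightarrow> d' \<in> L v \<Longrightarrow>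
           R u v c d \<Longrightarrow> R u v c d' \<Longrightarrow> d = d'"
  using assms unfolding matching_cover_def by blast+

lemma coloringsD:
  assumes "f \<in> colorings V E L R"
  shows "f \<in> PiE V L"
    and "v \<in> V \<Longrightarrow> f v \<in> L v"
    and "u \<in> V \<Longrightarrow> v \<in> V \<Longrightarrow> {u, v} \<in> E \<Longrightarrow> \<not> R u v (f u) (f v)"
  using assms by (auto simp: colorings_def)

lemma coloringsI:
  assumes "f \<in> PiE V L"
    and "\<And>u v. u \<in> V \<Longrightarrow> v \<in> V \<Longrightarrow> {u, v} \<in> E \<Longrightarrow> R u v (f u) (f v) \<Longrightarrow> False"
  shows "f \<in> colorings V E L R"
  using assms unfolding colorings_def by blast

lemma matching_cover_eq:
  "matching_cover V E m (\<lambda>_. {0..<m}) (\<lambda>_ _. (=))"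
  by (auto simp: matching_cover_def)

lemma finite_colorings:
  assumes "finite V" "\<And>v. v \<in> V \<Longrightarrow> finite (L v)"
  shows "finite (colorings V E L R)"
proof -
  have "finite (PiE V L)" using assms by (intro finite_PiE) auto
  then show ?thesis unfolding colorings_def by simp
qed

lemma simple_graph_no_loop: "simple_graph V E \<Longrightarrow> {u, v} \<in> E \<Longrightarrow> u \<noteq> v"
  unfolding simple_graph_def by (metis doubleton_eq_iff)

lemma simple_graph_endpoints: "simple_graph V E \<Longrightarrow> {u, v} \<in> E \<Longrightarrow> u \<in> V \<and> v \<in> V"
  unfolding simple_graph_def by (metis doubleton_eq_iff)

section \<open>Conflict relations and covers of minimal count\<close>

text \<open>Numbering each list by \<open>{0..<m}\<close> copies the conflicts into a cover on
  \<open>'v \<times> nat\<close>, the type over which \<open>dp_chrom\<close> minimises, whatever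
  the colour type \<open>'c\<close> is. Its lists are cliques, so an independent set of size
  \<open>card V\<close> takes one point from each list and comes from a colouring.\<close>

lemma ex_mfold_cover_dp_count_le:
  fixes V :: "'v set" and L :: "'v \<Rightarrow> 'c set"
  assumes G: "simple_graph V E" and mc: "matching_cover V E m L R"
  shows "\<exists>(L' :: 'v \<Rightarrow> ('v \<times> nat) set) HV HE. is_mfold_cover V E m L' HV HE \<and>
           dp_count V HV HE \<le> card (colorings V E L R)"
proof -
  note D = matching_coverD[OF mc]
  have finV: "finite V" using G by (simp add: simple_graph_def)
  have "\<forall>v\<in>V. \<exists>e. bij_betw e (L v) {0..<m}"
    using D(1,2) by (metis ex_bij_betw_finite_nat)
  then obtain e where e: "\<And>v. v \<in> V \<Longrightarrow> bij_betw (e v) (L v) {0..<m}" by metis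
  have e_lt: "e v c < m" if "v \<in> V" "c \<in> L v" for v c
    using bij_betwE[OF e[OF that(1)]] that(2) by auto
  have e_inj: "c = c'" if "v \<in> V" "c \<in> L v" "c' \<in> L v" "e v c = e v c'" for v c c'
    using e[OF that(1)] that by (auto simp: bij_betw_def inj_on_def)
  define L' where "L' = (\<lambda>v::'v. {v} \<times> {0..<m})"
  define HE where "HE = {{(u, i), (u, j)} | u i j. u \<in> V \<and> i < m \<and> j < m \<and> i \<noteq> j} \<union>
      {{(u, e u c), (v, e v d)} | u v c d. u \<in> V \<and> v \<in> V \<and> {u, v} \<in> E \<and> c \<in> L u \<and> d \<in> L v \<and> R u v c d}"
  define HV where "HV = V \<times> {0..<m}"
  \<comment> \<open>An edge of \<open>HE\<close> forgets its direction; symmetry of \<open>R\<close>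
    allows it to be read from \<open>u\<close> to \<open>v\<close> in either case.\<close>
  have cross: "\<exists>c d. {u, v} \<in> E \<and> c \<in> L u \<and> d \<in> L v \<and> R u v c d \<and> i = e u c \<and> j = e v d"
    if "u \<noteq> v" "{(u, i), (v, j)} \<in> HE" "u \<in> V" "v \<in> V" for u v i j
  proof -
    from that obtain u' v' c d where *: "{(u, i), (v, j)} = {(u', e u' c), (v', e v' d)}"
      "u' \<in> V" "v' \<in> V" "{u', v'} \<in> E" "c \<in> L u'" "d \<in> L v'" "R u' v' c d"
      unfolding HE_def by (auto simp: doubleton_eq_iff)
    have "R v' u' d c" using D(3) * by blast
    with * show ?thesis by (auto simp: doubleton_eq_iff insert_commute)
  qed
  have within: "{(u, i), (u, j)} \<in> HE" if "u \<in> V" "i < m" "j < m" "i \<noteq> j" for u i j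
    unfolding HE_def using that by blast
  have sg: "simple_graph HV HE"
    unfolding simple_graph_def
  proof (intro conjI ballI)
    show "finite HV" using finV by (simp add: HV_def)
  next
    fix x assume "x \<in> HE"
    then consider u i j where "x = {(u, i), (u, j)}" "u \<in> V" "i < m" "j < m" "i \<noteq> j"
      | u v c d where "x = {(u, e u c), (v, e v d)}" "u \<in> V" "v \<in> V" "{u, v} \<in> E" "c \<in> L u" "d \<in> L v"
      unfolding HE_def by blast
    then show "\<exists>a b. x = {a, b} \<and> a \<in> HV \<and> b \<in> HV \<and> a \<noteq> b"
    proof cases
      case 1
      then have "(u, i) \<in> HV" "(u, j) \<in> HV" "(u, i) \<noteq> (u, j)" by (auto simp: HV_def)
      with 1(1) show ?thesis by blast
    next
      case 2
      then have "(u, e u c) \<in> HV" "(v, e v d) \<in> HV" "(u, e u c) \<noteq> (v, e v d)"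
        using simple_graph_no_loop[OF G 2(4)] e_lt by (auto simp: HV_def)
      with 2(1) show ?thesis by blast
    qed
  qed
  have "is_cover V E L' HV HE"
    unfolding is_cover_def
  proof (intro conjI ballI impI)
    show "simple_graph HV HE" by (rule sg)
    show "(\<Union>u\<in>V. L' u) = HV" by (auto simp: L'_def HV_def)
  next
    fix u v assume "u \<in> V" "v \<in> V" "u \<noteq> v"
    then show "L' u \<inter> L' v = {}" by (auto simp: L'_def)
  next
    fix u x y assume "u \<in> V" "x \<in> L' u" "y \<in> L' u" "x \<noteq> y"
    moreover from this have "x = (u, snd x)" "y = (u, snd y)" "snd x < m" "snd y < m"
      by (auto simp: L'_def)
    ultimately show "{x, y} \<in> HE" using within by metis
  next
    fix u v assume uv: "u \<in> V" "v \<in> V" "edges_between HE (L' u) (L' v) \<noteq> {}"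
    show "u = v \<or> {u, v} \<in> E"
    proof (cases "u = v")
      case False
      from uv obtain i j where "{(u, i), (v, j)} \<in> HE"
        by (auto simp: edges_between_def L'_def)
      from cross[OF False this uv(1,2)] show ?thesis by blast
    qed simp
  next
    fix u v e1 e2
    assume uv: "u \<in> V" "v \<in> V" "{u, v} \<in> E" and
      12: "e1 \<in> edges_between HE (L' u) (L' v)" "e2 \<in> edges_between HE (L' u) (L' v)" "e1 \<noteq> e2"
    have ne: "u \<noteq> v" using simple_graph_no_loop[OF G] uv(3) by blast
    from 12 obtain i j i' j' where e1: "e1 = {(u, i), (v, j)}" "e1 \<in> HE"
      and e2: "e2 = {(u, i'), (v, j')}" "e2 \<in> HE"
      by (auto simp: edges_between_def L'_def)
    obtain c d where cd: "c \<in> L u" "d \<in> L v" "R u v c d" "i = e u c" "j = e v d"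
      using cross[OF ne] e1 uv by blast
    obtain c' d' where cd': "c' \<in> L u" "d' \<in> L v" "R u v c' d'" "i' = e u c'" "j' = e v d'"
      using cross[OF ne] e2 uv by blast
    have vu: "{v, u} \<in> E" using uv(3) by (simp add: insert_commute)
    \<comment> \<open>Functionality of \<open>R\<close> from \<open>u\<close> to \<open>v\<close>
      separates the endpoints over \<open>u\<close>; symmetry and functionality from
      \<open>v\<close> to \<open>u\<close> separate those over \<open>v\<close>.\<close>
    have "i \<noteq> i'" 
    proof
      assume "i = i'"
      then have "c = c'" using cd cd' e_inj uv by blast
      then have "d = d'" using cd cd' D(4) uv by blast
      then show False using e1 e2 12 cd cd' \<open>c = c'\<close> by simp
    qed
    moreover have "j \<noteq> j'" 
    proof
      assume "j = j'"
      then have "d = d'" using cd cd' e_inj uv by blast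
      moreover have "R v u d c" "R v u d' c'" using cd cd' D(3) uv by blast+
      ultimately have "c = c'" using cd cd' D(4) uv vu by blast
      then show False using e1 e2 12 cd cd' \<open>d = d'\<close> by simp
    qed
    ultimately show "e1 \<inter> e2 = {}" using e1 e2 ne by auto
  qed
  then have "is_mfold_cover V E m L' HV HE" by (simp add: is_mfold_cover_def L'_def)
  moreover have "dp_count V HV HE \<le> card (colorings V E L R)"
    unfolding dp_count_def
  proof (rule surj_card_le)
    show "finite (colorings V E L R)" using finV D(1) by (rule finite_colorings)
    show "{I. I \<subseteq> HV \<and> card I = card V \<and> (\<forall>x\<in>I. \<forall>y\<in>I. {x, y} \<notin> HE)}
        \<subseteq> (\<lambda>f. (\<lambda>v. (v, e v (f v))) ` V) ` colorings V E L R"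
    proof
      fix I assume "I \<in> {I. I \<subseteq> HV \<and> card I = card V \<and> (\<forall>x\<in>I. \<forall>y\<in>I. {x, y} \<notin> HE)}"
      then have I: "I \<subseteq> HV" "card I = card V" "\<And>x y. x \<in> I \<Longrightarrow> y \<in> I \<Longrightarrow> {x, y} \<notin> HE" by auto
      \<comment> \<open>\<open>I\<close> meets the clique over each vertex at most once; having
        \<open>card V\<close> elements, it meets each exactly once and is the graph of a function
        \<open>g\<close>.\<close>
      have uniq: "i = j" if "(v, i) \<in> I" "(v, j) \<in> I" for v i j
      proof (rule ccontr)
        assume "i \<noteq> j"
        moreover have "v \<in> V" "i < m" "j < m" using that I(1) by (auto simp: HV_def)
        ultimately show False using within I(3)[OF that] by blast
      qed
      then have "inj_on fst I" by (auto simp: inj_on_def)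
      then have "card (fst ` I) = card V" using I(2) by (simp add: card_image)
      moreover have "fst ` I \<subseteq> V" using I(1) by (auto simp: HV_def)
      ultimately have "fst ` I = V" using finV by (metis card_subset_eq)
      then have "\<forall>v\<in>V. \<exists>i. (v, i) \<in> I" by force
      then obtain g where g: "\<And>v. v \<in> V \<Longrightarrow> (v, g v) \<in> I" by metis
      have "\<forall>v\<in>V. \<exists>c. c \<in> L v \<and> e v c = g v"
      proof
        fix v assume v: "v \<in> V"
        have "(v, g v) \<in> HV" using g[OF v] I(1) by blast
        then have "g v \<in> {0..<m}" by (simp add: HV_def)
        then have "g v \<in> e v ` L v" using e[OF v] by (simp add: bij_betw_def)
        then show "\<exists>c. c \<in> L v \<and> e v c = g v" by auto
      qed
      then obtain f0 where f0: "\<And>v. v \<in> V \<Longrightarrow> f0 v \<in> L v" "\<And>v. v \<in> V \<Longrightarrow> e v (f0 v) = g v" by metis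
      define f where "f = restrict f0 V"
      have "f \<in> colorings V E L R"
        unfolding colorings_def
      proof (intro CollectI conjI ballI impI notI)
        show "f \<in> PiE V L" using f0 by (auto simp: f_def)
      next
        fix u v assume uv: "u \<in> V" "v \<in> V" "{u, v} \<in> E" "R u v (f u) (f v)"
        have "R u v (f0 u) (f0 v)" using uv by (simp add: f_def)
        then have "{(u, e u (f0 u)), (v, e v (f0 v))} \<in> HE"
          unfolding HE_def using uv(1-3) f0(1) by blast
        then show False using I(3)[OF g[OF uv(1)] g[OF uv(2)]] f0 uv by simp
      qed
      moreover have "I = (\<lambda>v. (v, e v (f v))) ` V"
      proof (rule set_eqI)
        fix x :: "'v \<times> nat"
        obtain v i where x: "x = (v, i)" by fastforce
        show "x \<in> I \<longleftrightarrow> x \<in> (\<lambda>v. (v, e v (f v))) ` V"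
        proof
          assume xI: "x \<in> I"
          then have v: "v \<in> V" using x I(1) unfolding HV_def by blast
          have "i = g v" using uniq g[OF v] xI x by blast
          then show "x \<in> (\<lambda>v. (v, e v (f v))) ` V" using v f0 x by (auto simp: f_def)
        next
          assume "x \<in> (\<lambda>v. (v, e v (f v))) ` V"
          then show "x \<in> I" using g f0 by (auto simp: f_def)
        qed
      qed
      ultimately show "I \<in> (\<lambda>f. (\<lambda>v. (v, e v (f v))) ` V) ` colorings V E L R" by blast
    qed
  qed
  ultimately show ?thesis by blast
qed

lemma dp_chrom_le:
  fixes V :: "'v set"
  assumes "simple_graph V E" "matching_cover V E m L R"
  shows "dp_chrom V E m \<le> card (colorings V E L R)"
  using ex_mfold_cover_dp_count_le[OF assms]
proof (elim exE conjE)
  fix L' :: "'v \<Rightarrow> ('v \<times> nat) set" and HV HE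
  assume cov: "is_mfold_cover V E m L' HV HE"
    and le: "dp_count V HV HE \<le> card (colorings V E L R)"
  have "dp_chrom V E m \<le> dp_count V HV HE"
    unfolding dp_chrom_def
  proof (rule cInf_lower)
    show "dp_count V HV HE \<in> {dp_count V HV HE | (L :: 'v \<Rightarrow> ('v \<times> nat) set) HV HE.
        is_mfold_cover V E m L HV HE}"
      using cov by blast
  qed simp
  with le show ?thesis by simp
qed

lemma dp_chrom_le_chrom: "simple_graph V E \<Longrightarrow> dp_chrom V E m \<le> chrom V E m"
  unfolding chrom_eq_card_colorings by (rule dp_chrom_le[OF _ matching_cover_eq])

text \<open>The infimum of a nonempty set of naturals is attained, and adjacency in a minimising
  cover serves as the conflict relation. Lists of a cover are disjoint, so distinct colourings have
  distinct images, and these are independent sets.\<close>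

lemma ex_matching_cover_le_dp_chrom:
  fixes V :: "'v set"
  assumes G: "simple_graph V E"
  shows "\<exists>(L :: 'v \<Rightarrow> ('v \<times> nat) set) R. matching_cover V E m L R \<and>
           card (colorings V E L R) \<le> dp_chrom V E m"
proof -
  let ?S = "{dp_count V HV HE | (L :: 'v \<Rightarrow> ('v \<times> nat) set) HV HE. is_mfold_cover V E m L HV HE}"
  \<comment> \<open>The cover with equality as conflict shows that \<open>m\<close>-fold covers
    exist.\<close>
  have "?S \<noteq> {}"
    using ex_mfold_cover_dp_count_le[OF G matching_cover_eq] by blast
  then have "dp_chrom V E m \<in> ?S"
    unfolding dp_chrom_def by (rule Inf_nat_def1)
  then obtain L :: "'v \<Rightarrow> ('v \<times> nat) set" and HV HE where
    mf: "is_mfold_cover V E m L HV HE" and dp: "dp_chrom V E m = dp_count V HV HE" by blast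
  have fin: "\<And>u. u \<in> V \<Longrightarrow> finite (L u)" "\<And>u. u \<in> V \<Longrightarrow> card (L u) = m"
    and cov: "is_cover V E L HV HE"
    using mf by (simp_all add: is_mfold_cover_def)
  note cov = cov[unfolded is_cover_def]
  have H: "simple_graph HV HE" using cov by (elim conjE)
  have UN: "(\<Union>u\<in>V. L u) = HV" using cov by (elim conjE)
  have disj: "L u \<inter> L v = {}" if "u \<in> V" "v \<in> V" "u \<noteq> v" for u v
    using that cov[THEN conjunct2, THEN conjunct2, THEN conjunct1] by blast
  have between: "u = v \<or> {u, v} \<in> E"
    if "u \<in> V" "v \<in> V" "edges_between HE (L u) (L v) \<noteq> {}" for u v
    using that cov[THEN conjunct2, THEN conjunct2, THEN conjunct2, THEN conjunct2, THEN conjunct1] by blast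
  have matching: "e1 \<inter> e2 = {}"
    if "u \<in> V" "v \<in> V" "{u, v} \<in> E" "e1 \<in> edges_between HE (L u) (L v)"
      "e2 \<in> edges_between HE (L u) (L v)" "e1 \<noteq> e2" for u v e1 e2
    using that cov[THEN conjunct2, THEN conjunct2, THEN conjunct2, THEN conjunct2, THEN conjunct2] by blast
  define R where "R = (\<lambda>(u::'v) (v::'v) x y. {x, y} \<in> HE)"
  have "matching_cover V E m L R"
    unfolding matching_cover_def
  proof (intro conjI ballI impI)
    fix u v c d d' assume uv: "u \<in> V" "v \<in> V" "{u, v} \<in> E"
      and cd: "c \<in> L u" "d \<in> L v" "d' \<in> L v" "R u v c d" "R u v c d'"
    have "{c, d} \<in> edges_between HE (L u) (L v)" "{c, d'} \<in> edges_between HE (L u) (L v)"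
      using cd by (auto simp: edges_between_def R_def)
    from matching[OF uv this] show "d = d'" by (auto simp: doubleton_eq_iff)
  qed (auto simp: fin R_def insert_commute)
  moreover have "card (colorings V E L R) \<le> dp_count V HV HE"
    unfolding dp_count_def
  proof (rule card_inj_on_le)
    have "finite (Pow HV)" using H by (simp add: simple_graph_def)
    then show "finite {I. I \<subseteq> HV \<and> card I = card V \<and> (\<forall>x\<in>I. \<forall>y\<in>I. {x, y} \<notin> HE)}"
      by (rule rev_finite_subset) auto
    show "inj_on (\<lambda>f. f ` V) (colorings V E L R)"
    proof (rule inj_onI)
      fix f g assume f: "f \<in> colorings V E L R" and g: "g \<in> colorings V E L R" and eq: "f ` V = g ` V"
      show "f = g"
      proof (rule PiE_ext)
        show "f \<in> PiE V L" "g \<in> PiE V L" using f g coloringsD(1) by blast+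
        fix v assume v: "v \<in> V"
        then obtain u where u: "u \<in> V" "f v = g u" using eq by blast
        have "f v \<in> L v" "g u \<in> L u" using coloringsD(2)[OF f v] coloringsD(2)[OF g u(1)] .
        then have "u = v" using disj u v by (metis disjoint_iff)
        then show "f v = g v" using u by simp
      qed
    qed
    show "(\<lambda>f. f ` V) ` colorings V E L R \<subseteq>
      {I. I \<subseteq> HV \<and> card I = card V \<and> (\<forall>x\<in>I. \<forall>y\<in>I. {x, y} \<notin> HE)}"
    proof (rule image_subsetI, intro CollectI conjI ballI)
      fix f assume f: "f \<in> colorings V E L R"
      then have fL: "\<And>v. v \<in> V \<Longrightarrow> f v \<in> L v" by (rule coloringsD(2))
      then show "f ` V \<subseteq> HV" using UN by blast
      have "inj_on f V" using fL disj by (metis disjoint_iff inj_onI)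
      then show "card (f ` V) = card V" by (rule card_image)
      fix x y assume "x \<in> f ` V" "y \<in> f ` V"
      then obtain u v where uv: "u \<in> V" "v \<in> V" "x = f u" "y = f v" by auto
      show "{x, y} \<notin> HE"
      proof
        assume xy: "{x, y} \<in> HE"
        \<comment> \<open>\<open>u = v\<close> would make \<open>{x, y}\<close> a loop; hence this
          edge of the cover lies over an edge of the graph, where the colouring forbids it.\<close>
        then have "x \<noteq> y" using simple_graph_no_loop[OF H] by blast
        then have "u \<noteq> v" using uv by blast
        moreover have "{x, y} \<in> edges_between HE (L u) (L v)"
          using xy uv fL by (auto simp: edges_between_def)
        ultimately have "{u, v} \<in> E" using between uv by blast
        then show False using coloringsD(3)[OF f uv(1,2)] uv xy by (simp add: R_def)
      qed
    qed
  qed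
  ultimately show ?thesis using dp by auto
qed

section \<open>Colourings gained from an imperfect matching\<close>

lemma matching_cover_mono:
  assumes "matching_cover V E k L R" "U \<subseteq> V"
  shows "matching_cover U E k L R"
  using assms unfolding matching_cover_def by (meson subsetD)

text \<open>\<open>P\<close> is a partial matching between sets of equal size, so it leaves equally
  many elements unmatched on both sides, and any bijection between these completes it. In this way
  lists can be identified along matchings that need not be perfect.\<close>

lemma ex_bij_betw_extending:
  assumes "finite A" "finite B" "card A = card B"
    and fct: "\<And>c d d'. c \<in> A \<Longrightarrow> d \<in> B \<Longrightarrow> d' \<in> B \<Longrightarrow> P c d \<Longrightarrow> P c d' \<Longrightarrow> d = d'"
    and inj: "\<And>c c' d. c \<in> A \<Longrightarrow> c' \<in> A \<Longrightarrow> d \<in> B \<Longrightarrow> P c d \<Longrightarrow> P c' d \<Longrightarrow> c = c'"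
  shows "\<exists>h. bij_betw h A B \<and> (\<forall>c\<in>A. \<forall>d\<in>B. P c d \<longrightarrow> h c = d)"
proof -
  define A0 where "A0 = {c \<in> A. \<exists>d\<in>B. P c d}"
  have "\<forall>c\<in>A0. \<exists>d. d \<in> B \<and> P c d" by (auto simp: A0_def)
  then obtain g where "\<forall>c\<in>A0. g c \<in> B \<and> P c (g c)" by (rule bchoice[THEN exE])
  then have g: "\<And>c. c \<in> A0 \<Longrightarrow> g c \<in> B" "\<And>c. c \<in> A0 \<Longrightarrow> P c (g c)" by auto
  have A0: "A0 \<subseteq> A" by (auto simp: A0_def)
  have injg: "inj_on g A0" using inj g A0 by (intro inj_onI) (metis subsetD)
  have gB: "g ` A0 \<subseteq> B" using g by auto
  have "finite A0" using A0 assms(1) by (rule finite_subset)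
  then have "card (A - A0) = card (B - g ` A0)"
    using assms(3) A0 gB by (simp add: card_Diff_subset card_image[OF injg])
  then obtain k where k: "bij_betw k (A - A0) (B - g ` A0)"
    using finite_same_card_bij[of "A - A0" "B - g ` A0"] assms(1,2) by auto
  define h where "h = (\<lambda>c. if c \<in> A0 then g c else k c)"
  have "bij_betw h A0 (g ` A0)"
    using injg by (auto simp: bij_betw_def h_def inj_on_def)
  moreover have "bij_betw h (A - A0) (B - g ` A0)"
    using k by (rule bij_betw_cong[THEN iffD1, rotated]) (simp add: h_def)
  ultimately have "bij_betw h (A0 \<union> (A - A0)) (g ` A0 \<union> (B - g ` A0))"
    by (rule bij_betw_combine) auto
  moreover have "A0 \<union> (A - A0) = A" "g ` A0 \<union> (B - g ` A0) = B" using A0 gB by auto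
  ultimately have "bij_betw h A B" by simp
  moreover have "h c = d" if "c \<in> A" "d \<in> B" "P c d" for c d
  proof -
    have "c \<in> A0" using that by (auto simp: A0_def)
    then show ?thesis using fct that g by (simp add: h_def)
  qed
  ultimately show ?thesis by blast
qed

text \<open>Functions in \<open>PiE U L\<close> are \<open>undefined\<close> at \<open>t\<close>, so
  overwriting that value loses no information.\<close>

lemma inj_on_fun_upd_PiE:
  assumes "t \<notin> U"
  shows "inj_on (\<lambda>(d, g). g(t := d)) (A \<times> PiE U L)"
proof (rule inj_onI, clarify)
  fix d d' g g'
  assume g: "g \<in> PiE U L" "g' \<in> PiE U L" and eq: "g(t := d) = g'(t := d')"
  from eq have "d = d'" by (metis fun_upd_same)
  moreover have "g t = undefined" "g' t = undefined" using PiE_arb[OF g(1) assms] PiE_arb[OF g(2) assms] .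
  then have "g = g'" using eq by (metis fun_upd_idem fun_upd_upd)
  ultimately show "d = d' \<and> g = g'" by simp
qed

text \<open>Greedy extension: each vertex already coloured forbids at most one colour of the next
  vertex. The common bound \<open>n\<close> on the number of all vertices gives the same factor
  \<open>k - n\<close> at every step, hence a pure power.\<close>

lemma card_coloring_extensions_ge:
  assumes "finite T" "finite S" "S \<inter> T = {}" "matching_cover (S \<union> T) E k L R"
    and "\<And>v. {v} \<notin> E" "card (S \<union> T) \<le> n" "f \<in> colorings S E L R"
  shows "(k - n) ^ card T \<le> card {g \<in> colorings (S \<union> T) E L R. \<forall>s\<in>S. g s = f s}"
  using assms(1,3,4,6)
proof (induction T rule: finite_induct)
  case empty
  have "{g \<in> colorings (S \<union> {}) E L R. \<forall>s\<in>S. g s = f s} = {f}"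
  proof -
    have "g = f" if "g \<in> colorings S E L R" "\<forall>s\<in>S. g s = f s" for g
      using coloringsD(1)[OF that(1)] coloringsD(1)[OF assms(7)] that(2) by (auto intro: PiE_ext)
    then show ?thesis using assms(7) by auto
  qed
  then show ?case by simp
next
  case (insert t T)
  let ?U = "S \<union> T"
  let ?G = "{g \<in> colorings ?U E L R. \<forall>s\<in>S. g s = f s}"
  let ?G' = "{g \<in> colorings (S \<union> insert t T) E L R. \<forall>s\<in>S. g s = f s}"
  note D = matching_coverD[OF insert.prems(2)]
  have tU: "t \<notin> ?U" using insert by auto
  have finU: "finite ?U" using insert assms(2) by simp
  have cardU: "card ?U \<le> n" using insert.prems(3) tU finU by simp
  have mcU: "matching_cover ?U E k L R"
    using insert.prems(2) by (rule matching_cover_mono) auto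
  have IH: "(k - n) ^ card T \<le> card ?G"
    using insert.IH insert.prems mcU cardU by auto
  \<comment> \<open>\<open>bad g\<close> collects the colours of \<open>t\<close> that
    \<open>g\<close> forbids, at most one for each vertex of \<open>S \<union> T\<close>.\<close>
  define bad where "bad g = (\<Union>x\<in>?U. {d \<in> L t. {x, t} \<in> E \<and> R x t (g x) d})" for g
  have finLt: "finite (L t)" "card (L t) = k" using D by auto
  have ext: "k - n \<le> card (L t - bad g)" if "g \<in> ?G" for g
  proof -
    have "card {d \<in> L t. {x, t} \<in> E \<and> R x t (g x) d} \<le> 1" if "x \<in> ?U" for x
    proof -
      have gx: "g x \<in> L x" using \<open>g \<in> ?G\<close> that coloringsD(2)[of g ?U E L R x] by simp
      have "\<forall>d\<in>{d \<in> L t. {x, t} \<in> E \<and> R x t (g x) d}.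
          \<forall>d'\<in>{d \<in> L t. {x, t} \<in> E \<and> R x t (g x) d}. d = d'"
        using D(4)[of x t "g x"] that gx by auto
      then show ?thesis using finLt by (simp add: card_le_Suc0_iff_eq)
    qed
    then have "(\<Sum>x\<in>?U. card {d \<in> L t. {x, t} \<in> E \<and> R x t (g x) d}) \<le> (\<Sum>x\<in>?U. 1)"
      by (rule sum_mono)
    moreover have "card (bad g) \<le> (\<Sum>x\<in>?U. card {d \<in> L t. {x, t} \<in> E \<and> R x t (g x) d})"
      unfolding bad_def by (rule card_UN_le[OF finU])
    ultimately have "card (bad g) \<le> card ?U" by simp
    moreover have "card (L t) - card (bad g) \<le> card (L t - bad g)"
      by (rule diff_card_le_card_Diff) (use finLt finU in \<open>auto simp: bad_def\<close>)
    ultimately show ?thesis using cardU finLt by simp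
  qed
  \<comment> \<open>Pairs of an allowed colour for \<open>t\<close> and a colouring of the rest;
    tagging by \<open>g\<close> keeps the choices for different \<open>g\<close> disjoint.\<close>
  let ?X = "\<Union>g\<in>?G. (\<lambda>d. (d, g)) ` (L t - bad g)"
  have "(k - n) ^ card (insert t T) = (k - n) * (k - n) ^ card T" using insert by simp
  also have "\<dots> \<le> (k - n) * card ?G" using IH by simp
  also have "\<dots> = (\<Sum>g\<in>?G. k - n)" by simp
  also have "\<dots> \<le> (\<Sum>g\<in>?G. card ((\<lambda>d. (d, g)) ` (L t - bad g)))"
  proof (rule sum_mono)
    fix g assume "g \<in> ?G"
    then show "k - n \<le> card ((\<lambda>d. (d, g)) ` (L t - bad g))"
      using ext by (subst card_image) (auto intro: inj_onI)
  qed
  also have "\<dots> = card ?X"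
  proof (rule card_UN_disjoint[symmetric])
    show "finite ?G" using finite_colorings[OF finU, of L E R] D(1) by auto
  qed (use finLt in auto)
  also have "\<dots> \<le> card ?G'"
  proof (rule card_inj_on_le)
    show "inj_on (\<lambda>(d, g). g(t := d)) ?X"
      by (rule inj_on_subset[OF inj_on_fun_upd_PiE[OF tU, of UNIV L]]) (auto dest: coloringsD(1))
    show "finite ?G'"
      using finite_colorings[of "S \<union> insert t T" L E R] finU D(1) by auto
    show "(\<lambda>(d, g). g(t := d)) ` ?X \<subseteq> ?G'"
    proof (rule image_subsetI)
      fix x assume "x \<in> ?X"
      then obtain d g where x: "x = (d, g)" and d: "d \<in> L t" "d \<notin> bad g"
        and g: "g \<in> colorings ?U E L R" "\<forall>s\<in>S. g s = f s"
        by auto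
      have ok: "\<not> R x t (g x) d" if "x \<in> ?U" "{x, t} \<in> E" for x
        using d that unfolding bad_def by blast
      have "g(t := d) \<in> colorings (S \<union> insert t T) E L R"
      proof (rule coloringsI)
        have "g(t := d) \<in> PiE (insert t ?U) L"
          by (rule PiE_fun_upd[OF d(1) coloringsD(1)[OF g(1)]])
        then show "g(t := d) \<in> PiE (S \<union> insert t T) L" by simp
      next
        fix u v assume uv: "u \<in> S \<union> insert t T" "v \<in> S \<union> insert t T" "{u, v} \<in> E"
          and R: "R u v ((g(t := d)) u) ((g(t := d)) v)"
        have ne: "u \<noteq> v" using uv(3) assms(5) by auto
        consider "u = t" "v \<in> ?U" "v \<noteq> t" | "v = t" "u \<in> ?U" "u \<noteq> t" | "u \<in> ?U" "v \<in> ?U" "u \<noteq> t" "v \<noteq> t"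
          using uv ne tU by blast
        then show False
        proof cases
          case 1
          have gv: "g v \<in> L v" using coloringsD(2)[OF g(1) 1(2)] .
          have "R t v d (g v)" using R 1 by simp
          then have "R v t (g v) d" using D(3)[of t v d "g v"] 1 uv d gv by blast
          then show False using ok[of v] 1 uv by (simp add: insert_commute)
        next
          case 2
          then show False using ok[of u] uv R by simp
        next
          case 3
          then show False using coloringsD(3)[OF g(1)] uv R by auto
        qed
      qed
      moreover have "\<forall>s\<in>S. (g(t := d)) s = f s" using g tU by auto
      ultimately show "(case x of (d, g) \<Rightarrow> g(t := d)) \<in> ?G'" using x by simp
    qed
  qed
  finally show ?case .
qed

text \<open>Since neither \<open>a\<close> nor \<open>b\<close> has a partner across the edge,
  joining them yields another cover, which still has at least \<open>dp_chrom V E k\<close>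
  colourings. The new conflict destroys the colourings with \<open>a\<close> at \<open>u\<close> and
  \<open>b\<close> at \<open>v\<close>, and greedy extension from \<open>{u, v}\<close> to the other
  \<open>card V - 2\<close> vertices bounds their number from below.\<close>

lemma dp_chrom_add_edge_le:
  fixes V :: "'v set"
  assumes G: "simple_graph V E" and mc: "matching_cover V E k L R"
    and uv: "{u, v} \<in> E" and a: "a \<in> L u" and b: "b \<in> L v"
    and ua: "\<And>q. q \<in> L v \<Longrightarrow> \<not> R u v a q" and ub: "\<And>p. p \<in> L u \<Longrightarrow> \<not> R u v p b"
  shows "dp_chrom V E k + (k - card V) ^ (card V - 2) \<le> card (colorings V E L R)"
proof -
  note D = matching_coverD[OF mc]
  have ne: "u \<noteq> v" using simple_graph_no_loop[OF G uv] .
  have V: "u \<in> V" "v \<in> V" using simple_graph_endpoints[OF G uv] by auto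
  have noloop: "{x} \<notin> E" for x using simple_graph_no_loop[OF G, of x x] by auto
  have finV: "finite V" using G by (simp add: simple_graph_def)
  have vu: "{v, u} \<in> E" using uv by (simp add: insert_commute)
  have vub: "\<not> R v u b p" if "p \<in> L u" for p
    using D(3)[of v u b p] ub that V b vu by blast
  define R' where "R' = (\<lambda>x y p q. R x y p q \<or> (x = u \<and> y = v \<and> p = a \<and> q = b) \<or>
      (x = v \<and> y = u \<and> p = b \<and> q = a))"
  have "matching_cover V E k L R'"
    unfolding matching_cover_def
  proof (intro conjI ballI impI)
    fix x y p q assume "x \<in> V" "y \<in> V" "{x, y} \<in> E" "p \<in> L x" "q \<in> L y" "R' x y p q"
    then show "R' y x q p" unfolding R'_def using D(3)[of x y p q] by blast
  next
    fix x y p q q' assume *: "x \<in> V" "y \<in> V" "{x, y} \<in> E" "p \<in> L x" "q \<in> L y" "q' \<in> L y"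
      "R' x y p q" "R' x y p q'"
    show "q = q'"
    proof (cases "R x y p q \<and> R x y p q'")
      case True
      then show ?thesis using D(4)[of x y p q q'] * by blast
    next
      case False
      then show ?thesis using * ne ua vub unfolding R'_def by metis
    qed
  qed (use D in auto)
  then have "dp_chrom V E k \<le> card (colorings V E L R')" by (rule dp_chrom_le[OF G])
  moreover have "(k - card V) ^ (card V - 2) \<le> card {g \<in> colorings V E L R. g u = a \<and> g v = b}"
  proof -
    define f where "f = (\<lambda>x\<in>{u, v}. if x = u then a else b)"
    have f: "f \<in> colorings {u, v} E L R"
    proof (rule coloringsI)
      show "f \<in> PiE {u, v} L" using a b by (auto simp: f_def)
    next
      fix x y assume "x \<in> {u, v}" "y \<in> {u, v}" "{x, y} \<in> E" "R x y (f x) (f y)"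
      then show False using noloop ne ua[OF b] vub[OF a] by (auto simp: f_def)
    qed
    have U: "{u, v} \<union> (V - {u, v}) = V" using V by auto
    have cT: "card (V - {u, v}) = card V - 2" using V ne finV by (simp add: card_Diff_subset)
    have "(k - card V) ^ card (V - {u, v}) \<le>
        card {g \<in> colorings ({u, v} \<union> (V - {u, v})) E L R. \<forall>s\<in>{u, v}. g s = f s}"
      by (rule card_coloring_extensions_ge) (use finV U mc noloop f in auto)
    moreover have "{g \<in> colorings V E L R. \<forall>s\<in>{u, v}. g s = f s} =
        {g \<in> colorings V E L R. g u = a \<and> g v = b}"
      using ne by (auto simp: f_def)
    ultimately show ?thesis unfolding U cT by simp
  qed
  moreover have "card (colorings V E L R') + card {g \<in> colorings V E L R. g u = a \<and> g v = b} \<le>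
      card (colorings V E L R)"
  proof -
    have fin: "finite (colorings V E L R)" "finite (colorings V E L R')"
      using finV D(1) by (auto intro: finite_colorings)
    have "colorings V E L R' \<inter> {g \<in> colorings V E L R. g u = a \<and> g v = b} = {}"
      using V uv by (auto simp: colorings_def R'_def)
    then have "card (colorings V E L R') + card {g \<in> colorings V E L R. g u = a \<and> g v = b} =
        card (colorings V E L R' \<union> {g \<in> colorings V E L R. g u = a \<and> g v = b})"
      using fin by (simp add: card_Un_disjoint)
    also have "\<dots> \<le> card (colorings V E L R)"
      by (rule card_mono[OF fin(1)]) (auto simp: colorings_def R'_def)
    finally show ?thesis .
  qed
  ultimately show ?thesis by linarith
qed

section \<open>Colourings of a cone\<close>

lemma simple_graph_cone:
  assumes "simple_graph V E" "w \<notin> V"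
  shows "simple_graph (insert w V) (E \<union> {{w, v} | v. v \<in> V})"
  using assms unfolding simple_graph_def by blast

lemma cone_edge_iff:
  assumes "simple_graph V E" "w \<notin> V" "u \<in> V" "v \<in> V"
  shows "{u, v} \<in> E \<union> {{w, v} | v. v \<in> V} \<longleftrightarrow> {u, v} \<in> E"
  using assms by (auto simp: doubleton_eq_iff)

lemma card_proper_colorings_le_chrom:
  assumes "finite V" "finite S"
  shows "card (colorings V E (\<lambda>_. S) (\<lambda>_ _. (=))) \<le> chrom V E (card S)"
proof -
  obtain e where e: "bij_betw e S {0..<card S}" using ex_bij_betw_finite_nat[OF assms(2)] by blast
  then have inj: "inj_on e S" and eS: "e ` S = {0..<card S}" by (auto simp: bij_betw_def)
  let ?C = "colorings V E (\<lambda>_. S) (\<lambda>_ _. (=))"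
  let ?D = "colorings V E (\<lambda>_. {0..<card S}) (\<lambda>_ _. (=))"
  have "card ?C \<le> card ?D"
  proof (rule card_inj_on_le)
    show "inj_on (\<lambda>f. \<lambda>v\<in>V. e (f v)) ?C"
    proof (rule inj_onI)
      fix f g assume f: "f \<in> ?C" and g: "g \<in> ?C" and eq: "(\<lambda>v\<in>V. e (f v)) = (\<lambda>v\<in>V. e (g v))"
      show "f = g"
      proof (rule PiE_ext[OF coloringsD(1)[OF f] coloringsD(1)[OF g]])
        fix v assume v: "v \<in> V"
        have "e (f v) = e (g v)" using fun_cong[OF eq, of v] v by simp
        then show "f v = g v" using inj coloringsD(2)[OF f v] coloringsD(2)[OF g v] by (simp add: inj_on_eq_iff)
      qed
    qed
    show "(\<lambda>f. \<lambda>v\<in>V. e (f v)) ` ?C \<subseteq> ?D"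
    proof (rule image_subsetI)
      fix f assume f: "f \<in> ?C"
      show "(\<lambda>v\<in>V. e (f v)) \<in> ?D"
      proof (rule coloringsI)
        show "(\<lambda>v\<in>V. e (f v)) \<in> PiE V (\<lambda>_. {0..<card S})"
        proof (rule restrict_PiE_iff[THEN iffD2], rule ballI)
          fix v assume v: "v \<in> V"
          show "e (f v) \<in> {0..<card S}" using coloringsD(2)[OF f v] eS by blast
        qed
      next
        fix u v assume uv: "u \<in> V" "v \<in> V" "{u, v} \<in> E" "(\<lambda>v\<in>V. e (f v)) u = (\<lambda>v\<in>V. e (f v)) v"
        then have "f u = f v"
          using inj coloringsD(2)[OF f uv(1)] coloringsD(2)[OF f uv(2)] by (simp add: inj_on_eq_iff)
        then show False using coloringsD(3)[OF f uv(1-3)] by simp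
      qed
    qed
    show "finite ?D" using assms(1) by (rule finite_colorings) simp
  qed
  then show ?thesis by (simp add: chrom_eq_card_colorings)
qed

text \<open>The colour of the apex \<open>w\<close> is excluded on all of \<open>V\<close>, where
  \<open>m - 1\<close> colours remain. An upper bound suffices, since the deficit is only estimated
  from above.\<close>

lemma chrom_cone_le:
  assumes G: "simple_graph V E" and w: "w \<notin> V"
  shows "chrom (insert w V) (E \<union> {{w, v} | v. v \<in> V}) m \<le> m * chrom V E (m - 1)"
proof -
  have finV: "finite V" using G by (simp add: simple_graph_def)
  let ?C = "\<lambda>c. colorings V E (\<lambda>_. {0..<m} - {c}) (\<lambda>_ _. (=))"
  let ?D = "colorings (insert w V) (E \<union> {{w, v} | v. v \<in> V}) (\<lambda>_. {0..<m}) (\<lambda>_ _. (=))"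
  have fin: "finite (SIGMA c:{0..<m}. ?C c)"
    using finV by (intro finite_SigmaI finite_colorings) auto
  have "card ?D \<le> card (SIGMA c:{0..<m}. ?C c)"
  proof (rule card_inj_on_le[OF _ _ fin])
    show "inj_on (\<lambda>f. (f w, restrict f V)) ?D"
    proof (rule inj_onI)
      fix f g assume f: "f \<in> ?D" and g: "g \<in> ?D" and eq: "(f w, restrict f V) = (g w, restrict g V)"
      show "f = g"
      proof (rule PiE_ext[OF coloringsD(1)[OF f] coloringsD(1)[OF g]])
        fix v assume "v \<in> insert w V"
        then show "f v = g v"
          using eq by (cases "v = w") (simp, metis Pair_inject insertE restrict_apply')
      qed
    qed
    show "(\<lambda>f. (f w, restrict f V)) ` ?D \<subseteq> (SIGMA c:{0..<m}. ?C c)"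
    proof (rule image_subsetI, rule SigmaI)
      fix f assume f: "f \<in> ?D"
      show "f w \<in> {0..<m}" using coloringsD(2)[OF f] by blast
      show "restrict f V \<in> ?C (f w)"
      proof (rule coloringsI)
        have "f v \<in> {0..<m} - {f w}" if v: "v \<in> V" for v
        proof -
          have "{w, v} \<in> E \<union> {{w, v} | v. v \<in> V}" using v by blast
          then have "f w \<noteq> f v" using coloringsD(3)[OF f, of w v] v by simp
          moreover have "f v \<in> {0..<m}" using coloringsD(2)[OF f, of v] v by simp
          ultimately show ?thesis by simp
        qed
        then show "restrict f V \<in> PiE V (\<lambda>_. {0..<m} - {f w})"
          by (intro restrict_PiE_iff[THEN iffD2] ballI)
      next
        fix u v assume uv: "u \<in> V" "v \<in> V" "{u, v} \<in> E" "restrict f V u = restrict f V v"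
        then show False using coloringsD(3)[OF f, of u v] by simp
      qed
    qed
  qed
  also have "\<dots> = (\<Sum>c\<in>{0..<m}. card (?C c))"
    using finV by (intro card_SigmaI ballI finite_colorings) auto
  also have "\<dots> \<le> (\<Sum>c\<in>{0..<m}. chrom V E (m - 1))"
  proof (rule sum_mono)
    fix c assume "c \<in> {0..<m}"
    then have "card ({0..<m} - {c}) = m - 1" by simp
    then show "card (?C c) \<le> chrom V E (m - 1)"
      using card_proper_colorings_le_chrom[OF finV, of "{0..<m} - {c}" E] by simp
  qed
  also have "\<dots> = m * chrom V E (m - 1)" by simp
  finally show ?thesis by (simp add: chrom_eq_card_colorings)
qed

text \<open>The alternatives reflect whether identifying all lists with that of \<open>w\<close>
  turns every conflict inside \<open>V\<close> into equality. Failure requires an edge of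
  \<open>G\<close>; recording \<open>2 \<le> card V\<close> settles graphs with fewer than two
  vertices and keeps the exponent \<open>card V - 2\<close> from being truncated.\<close>

lemma dp_chrom_cone_ge:
  fixes V :: "'v set"
  assumes G: "simple_graph V E" and w: "w \<notin> V"
  defines "V' \<equiv> insert w V" and "E' \<equiv> E \<union> {{w, v} | v. v \<in> V}"
  shows "chrom V' E' m \<le> dp_chrom V' E' m \<or>
    2 \<le> card V \<and> m * dp_chrom V E (m - 1) + (m - 1 - card V) ^ (card V - 2) \<le> dp_chrom V' E' m"
proof -
  have finV: "finite V" using G by (simp add: simple_graph_def)
  have G': "simple_graph V' E'" unfolding V'_def E'_def using G w by (rule simple_graph_cone)
  have E'_iff: "{u, v} \<in> E' \<longleftrightarrow> {u, v} \<in> E" if "u \<in> V" "v \<in> V" for u v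
    unfolding E'_def using cone_edge_iff[OF G w that] .
  have wE': "{w, v} \<in> E'" "{v, w} \<in> E'" if "v \<in> V" for v
    using that by (auto simp: E'_def)
  obtain L :: "'v \<Rightarrow> ('v \<times> nat) set" and R where mc: "matching_cover V' E' m L R"
    and le: "card (colorings V' E' L R) \<le> dp_chrom V' E' m"
    using ex_matching_cover_le_dp_chrom[OF G', of m] by (elim exE conjE)
  note D = matching_coverD[OF mc]
  have wV': "w \<in> V'" and VV': "\<And>v. v \<in> V \<Longrightarrow> v \<in> V'" by (auto simp: V'_def)
  \<comment> \<open>The bijections \<open>\<pi> v\<close> identify the list of \<open>w\<close> with
    that of \<open>v\<close>, sending a colour of \<open>w\<close> to its partner at
    \<open>v\<close> whenever it has one.\<close>
  have "\<forall>v\<in>V. \<exists>h. bij_betw h (L w) (L v) \<and> (\<forall>c\<in>L w. \<forall>d\<in>L v. R w v c d \<longrightarrow> h c = d)"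
  proof
    fix v assume v: "v \<in> V"
    show "\<exists>h. bij_betw h (L w) (L v) \<and> (\<forall>c\<in>L w. \<forall>d\<in>L v. R w v c d \<longrightarrow> h c = d)"
    proof (rule ex_bij_betw_extending)
      fix c d d' assume "c \<in> L w" "d \<in> L v" "d' \<in> L v" "R w v c d" "R w v c d'"
      then show "d = d'" using D(4)[OF wV' VV'[OF v] wE'(1)[OF v]] by simp
    next
      fix c c' d assume *: "c \<in> L w" "c' \<in> L w" "d \<in> L v" "R w v c d" "R w v c' d"
      have "R v w d c" "R v w d c'" using D(3)[OF wV' VV'[OF v] wE'(1)[OF v]] * by simp_all
      then show "c = c'" using D(4)[OF VV'[OF v] wV' wE'(2)[OF v]] * by simp
    qed (use D(1,2)[OF wV'] D(1,2)[OF VV'[OF v]] in simp_all)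
  qed
  then obtain \<pi> where "\<forall>v\<in>V. bij_betw (\<pi> v) (L w) (L v) \<and> (\<forall>c\<in>L w. \<forall>d\<in>L v. R w v c d \<longrightarrow> \<pi> v c = d)"
    by (rule bchoice[THEN exE])
  then have \<pi>: "bij_betw (\<pi> v) (L w) (L v)"
    and \<pi>R: "\<And>c d. c \<in> L w \<Longrightarrow> d \<in> L v \<Longrightarrow> R w v c d \<Longrightarrow> \<pi> v c = d" if "v \<in> V" for v
    using that by auto
  have \<pi>_mem: "\<pi> v c \<in> L v" if "v \<in> V" "c \<in> L w" for v c
    using bij_betwE[OF \<pi>[OF that(1)]] that(2) by blast
  show ?thesis
  proof (cases "\<forall>u\<in>V. \<forall>v\<in>V. {u, v} \<in> E \<longrightarrow> (\<forall>c\<in>L w. \<forall>d\<in>L v. R u v (\<pi> u c) d \<longrightarrow> d = \<pi> v c)")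
    case True
    have "\<exists>e. bij_betw e {0..<m} (L w)"
      using D(1,2)[OF wV'] by (metis ex_bij_betw_nat_finite)
    then obtain e where e: "bij_betw e {0..<m} (L w)" by (elim exE)
    \<comment> \<open>All lists are numbered consistently: number the list of \<open>w\<close> by
      \<open>e\<close> and transport the numbering along \<open>\<pi>\<close>.\<close>
    define \<rho> where "\<rho> v = (if v = w then id else \<pi> v) \<circ> e" for v
    have \<rho>: "bij_betw (\<rho> v) {0..<m} (L v)" if "v \<in> V'" for v
    proof (cases "v = w")
      case True
      then show ?thesis using e by (simp add: \<rho>_def)
    next
      case False
      then have "v \<in> V" using that by (simp add: V'_def)
      then show ?thesis using bij_betw_trans[OF e \<pi>] False by (simp add: \<rho>_def)
    qed
    have e_mem: "e i \<in> L w" if "i < m" for i using bij_betwE[OF e] that by simp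
    have e_inj: "i = j" if "e i = e j" "i < m" "j < m" for i j
      using inj_onD[OF bij_betw_imp_inj_on[OF e] that(1)] that(2,3) by simp
    have \<pi>_inj: "c = c'" if "v \<in> V" "\<pi> v c = \<pi> v c'" "c \<in> L w" "c' \<in> L w" for v c c'
      using inj_onD[OF bij_betw_imp_inj_on[OF \<pi>[OF that(1)]] that(2-4)] .
    \<comment> \<open>In this numbering conflicting colours have equal numbers, so proper colourings
      by \<open>{0..<m}\<close> inject into the colourings of the cover.\<close>
    have identity: "i = j"
      if uv: "u \<in> V'" "v \<in> V'" "{u, v} \<in> E'" and "R u v (\<rho> u i) (\<rho> v j)" "i < m" "j < m" for u v i j
    proof -
      have ne: "u \<noteq> v" using simple_graph_no_loop[OF G' that(3)] .
      consider "u = w" "v \<in> V" "v \<noteq> w" | "v = w" "u \<in> V" "u \<noteq> w" | "u \<in> V" "v \<in> V" "u \<noteq> w" "v \<noteq> w"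
        using uv(1,2) ne w unfolding V'_def by blast
      then have "e i = e j"
      proof cases
        case 1
        then have "R w v (e i) (\<pi> v (e j))" using that(4) by (simp add: \<rho>_def)
        then have "\<pi> v (e i) = \<pi> v (e j)" using \<pi>R 1 e_mem that \<pi>_mem by simp
        then show ?thesis using \<pi>_inj 1 e_mem that by simp
      next
        case 2
        then have "R u w (\<pi> u (e i)) (e j)" using that(4) by (simp add: \<rho>_def)
        then have "R w u (e j) (\<pi> u (e i))"
          using D(3)[OF VV'[OF 2(2)] wV' wE'(2)[OF 2(2)]] e_mem that \<pi>_mem 2 by simp
        then have "\<pi> u (e j) = \<pi> u (e i)" using \<pi>R 2 e_mem that \<pi>_mem by simp
        then show ?thesis using \<pi>_inj 2 e_mem that by metis
      next
        case 3
        then have "R u v (\<pi> u (e i)) (\<pi> v (e j))" using that(4) by (simp add: \<rho>_def)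
        moreover have "{u, v} \<in> E" using E'_iff 3 that(3) by simp
        ultimately have "\<pi> v (e j) = \<pi> v (e i)" using True 3 e_mem that \<pi>_mem by simp
        then show ?thesis using \<pi>_inj 3 e_mem that by metis
      qed
      then show ?thesis using e_inj that by simp
    qed
    let ?D = "colorings V' E' (\<lambda>_. {0..<m}) (\<lambda>_ _. (=))"
    have "card ?D \<le> card (colorings V' E' L R)"
    proof (rule card_inj_on_le)
      show "finite (colorings V' E' L R)"
        using finV D(1) by (intro finite_colorings) (auto simp: V'_def)
      show "inj_on (\<lambda>f. \<lambda>v\<in>V'. \<rho> v (f v)) ?D"
      proof (rule inj_onI)
        fix f g assume f: "f \<in> ?D" and g: "g \<in> ?D"
          and eq: "(\<lambda>v\<in>V'. \<rho> v (f v)) = (\<lambda>v\<in>V'. \<rho> v (g v))"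
        show "f = g"
        proof (rule PiE_ext[OF coloringsD(1)[OF f] coloringsD(1)[OF g]])
          fix v assume v: "v \<in> V'"
          have "\<rho> v (f v) = \<rho> v (g v)" using fun_cong[OF eq, of v] v by simp
          then show "f v = g v"
            using inj_onD[OF bij_betw_imp_inj_on[OF \<rho>[OF v]]] coloringsD(2)[OF f v]
              coloringsD(2)[OF g v] by simp
        qed
      qed
      show "(\<lambda>f. \<lambda>v\<in>V'. \<rho> v (f v)) ` ?D \<subseteq> colorings V' E' L R"
      proof (rule image_subsetI)
        fix f assume f: "f \<in> ?D"
        show "(\<lambda>v\<in>V'. \<rho> v (f v)) \<in> colorings V' E' L R"
        proof (rule coloringsI)
          show "(\<lambda>v\<in>V'. \<rho> v (f v)) \<in> PiE V' L"
          proof (rule restrict_PiE_iff[THEN iffD2], rule ballI)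
            fix v assume v: "v \<in> V'"
            show "\<rho> v (f v) \<in> L v" using bij_betwE[OF \<rho>[OF v]] coloringsD(2)[OF f v] by simp
          qed
        next
          fix u v assume uv: "u \<in> V'" "v \<in> V'" "{u, v} \<in> E'"
            and "R u v ((\<lambda>v\<in>V'. \<rho> v (f v)) u) ((\<lambda>v\<in>V'. \<rho> v (f v)) v)"
          then have "R u v (\<rho> u (f u)) (\<rho> v (f v))" by simp
          then have "f u = f v"
            using identity[OF uv] coloringsD(2)[OF f uv(1)] coloringsD(2)[OF f uv(2)] by simp
          then show False using coloringsD(3)[OF f uv] by simp
        qed
      qed
    qed
    then show ?thesis using le by (simp add: chrom_eq_card_colorings)
  next
    case False
    \<comment> \<open>The partner \<open>d\<close> of \<open>\<pi> u c\<close> differs from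
      \<open>\<pi> v c\<close>, so giving \<open>c\<close> to \<open>w\<close> deletes
      \<open>\<pi> u c\<close> but spares \<open>d\<close>.\<close>
    then obtain u v c d where uv: "u \<in> V" "v \<in> V" "{u, v} \<in> E" and c: "c \<in> L w" and d: "d \<in> L v"
      and R: "R u v (\<pi> u c) d" and d_ne: "d \<noteq> \<pi> v c" by meson
    \<comment> \<open>Residual lists once \<open>w\<close> has colour \<open>c\<close>. The colour
      \<open>\<pi> v c\<close> is deleted even if it is not joined to \<open>c\<close>: this makes
      all lists have exactly \<open>m - 1\<close> colours and can only lose colourings, which a
      lower bound tolerates.\<close>
    define M where "M c v = L v - {\<pi> v c}" for c v
    have card_M: "finite (M c x)" "card (M c x) = m - 1" if "c \<in> L w" "x \<in> V" for c x
      using D(1,2)[OF VV'[OF that(2)]] \<pi>_mem[OF that(2,1)] by (simp_all add: M_def)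
    have mcM: "matching_cover V E (m - 1) (M c) R" if "c \<in> L w" for c
      unfolding matching_cover_def
    proof (intro conjI ballI impI)
      fix x y p q assume "x \<in> V" "y \<in> V" "{x, y} \<in> E" "p \<in> M c x" "q \<in> M c y" "R x y p q"
      then show "R y x q p" using D(3)[of x y p q] VV' E'_iff by (simp add: M_def)
    next
      fix x y p q q' assume *: "x \<in> V" "y \<in> V" "{x, y} \<in> E" "p \<in> M c x" "q \<in> M c y" "q' \<in> M c y"
        "R x y p q" "R x y p q'"
      show "q = q'"
        by (rule D(4)[of x y p q q']) (use * VV' E'_iff in \<open>simp_all add: M_def\<close>)
    qed (use card_M that in simp_all)
    \<comment> \<open>A colour of \<open>w\<close> together with a colouring from the residual lists
      determines a colouring of the cone, and distinct pairs give distinct colourings.\<close>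
    have residual: "(\<Sum>c\<in>L w. card (colorings V E (M c) R)) \<le> card (colorings V' E' L R)"
    proof -
      have "(\<Sum>c\<in>L w. card (colorings V E (M c) R)) = card (SIGMA c:L w. colorings V E (M c) R)"
        using D(1)[OF wV'] finV card_M
        by (intro card_SigmaI[symmetric] ballI finite_colorings) auto
      also have "\<dots> \<le> card (colorings V' E' L R)"
      proof (rule card_inj_on_le)
        show "finite (colorings V' E' L R)"
          using finV D(1) by (intro finite_colorings) (auto simp: V'_def)
        have "(SIGMA c:L w. colorings V E (M c) R) \<subseteq> L w \<times> PiE V L"
        proof (rule subsetI, elim SigmaE)
          fix x c f assume x: "x = (c, f)" "c \<in> L w" "f \<in> colorings V E (M c) R"
          have "f \<in> PiE V L" using coloringsD(1)[OF x(3)] by (auto simp: M_def PiE_iff)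
          then show "x \<in> L w \<times> PiE V L" using x by simp
        qed
        then show "inj_on (\<lambda>(c, f). f(w := c)) (SIGMA c:L w. colorings V E (M c) R)"
          by (rule inj_on_subset[OF inj_on_fun_upd_PiE[OF w]])
        show "(\<lambda>(c, f). f(w := c)) ` (SIGMA c:L w. colorings V E (M c) R) \<subseteq> colorings V' E' L R"
        proof (rule image_subsetI, elim SigmaE, simp)
          fix c f assume c: "c \<in> L w" and f: "f \<in> colorings V E (M c) R"
          have fM: "f x \<in> L x" "f x \<noteq> \<pi> x c" if "x \<in> V" for x
            using coloringsD(2)[OF f that] by (simp_all add: M_def)
          show "f(w := c) \<in> colorings V' E' L R"
          proof (rule coloringsI)
            have "f \<in> PiE V L" using coloringsD(1)[OF f] by (auto simp: M_def PiE_iff)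
            then show "f(w := c) \<in> PiE V' L" unfolding V'_def using c by (intro PiE_fun_upd)
          next
            fix x y assume xy: "x \<in> V'" "y \<in> V'" "{x, y} \<in> E'"
              and Rxy: "R x y ((f(w := c)) x) ((f(w := c)) y)"
            have ne: "x \<noteq> y" using simple_graph_no_loop[OF G' xy(3)] .
            consider "x = w" "y \<in> V" "y \<noteq> w" | "y = w" "x \<in> V" "x \<noteq> w"
              | "x \<in> V" "y \<in> V" "x \<noteq> w" "y \<noteq> w"
              using xy(1,2) ne w unfolding V'_def by blast
            then show False
            proof cases
              case 1
              then have "R w y c (f y)" using Rxy by simp
              then show False using \<pi>R[OF 1(2) c] fM[OF 1(2)] by metis
            next
              case 2
              then have "R x w (f x) c" using Rxy by simp
              then have "R w x c (f x)"
                using D(3)[OF VV'[OF 2(2)] wV' wE'(2)[OF 2(2)]] c fM[OF 2(2)] by simp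
              then show False using \<pi>R[OF 2(2) c] fM[OF 2(2)] by metis
            next
              case 3
              then show False using coloringsD(3)[OF f 3(1,2)] E'_iff xy(3) Rxy by simp
            qed
          qed
        qed
      qed
      finally show ?thesis .
    qed
    have base: "dp_chrom V E (m - 1) \<le> card (colorings V E (M c) R)" if "c \<in> L w" for c
      using dp_chrom_le[OF G mcM[OF that]] .
    note DM = matching_coverD[OF mcM[OF c]]
    have vu: "{v, u} \<in> E" using uv(3) by (simp add: insert_commute)
    have injM: "p = p'" if "p \<in> M c u" "p' \<in> M c u" "q \<in> M c v" "R u v p q" "R u v p' q" for p p' q
    proof -
      have "R v u q p" "R v u q p'" using DM(3)[OF uv] that by simp_all
      then show ?thesis using DM(4)[OF uv(2,1) vu] that by simp
    qed
    \<comment> \<open>The only partner of \<open>d \<in> M c v\<close> is the deleted colour \<open>\<pi> u c\<close>, so \<open>M c u\<close> cannot be matched into \<open>M c v\<close>.\<close>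
    have "\<exists>a\<in>M c u. \<forall>q\<in>M c v. \<not> R u v a q"
    proof (rule ccontr)
      assume "\<not> ?thesis"
      then have "\<forall>a\<in>M c u. \<exists>q. q \<in> M c v \<and> R u v a q" by blast
      then obtain h where h: "\<forall>a\<in>M c u. h a \<in> M c v \<and> R u v a (h a)" by (rule bchoice[THEN exE])
      have "h a \<noteq> d" if "a \<in> M c u" for a
      proof
        assume "h a = d"
        then have "R u v a d" using h that by auto
        have aL: "a \<in> L u" "a \<noteq> \<pi> u c" using that by (simp_all add: M_def)
        note D3 = D(3)[OF VV'[OF uv(1)] VV'[OF uv(2)]]
        have "{u, v} \<in> E'" "{v, u} \<in> E'" using E'_iff uv vu by simp_all
        then have "R v u d a" "R v u d (\<pi> u c)"
          using D3 \<open>R u v a d\<close> R aL d \<pi>_mem[OF uv(1) c] by simp_all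
        then have "a = \<pi> u c"
          using D(4)[OF VV'[OF uv(2)] VV'[OF uv(1)] \<open>{v, u} \<in> E'\<close> d] aL \<pi>_mem[OF uv(1) c] by simp
        then show False using aL by simp
      qed
      then have "h ` M c u \<subseteq> M c v - {d}" using h by blast
      moreover have "inj_on h (M c u)" using injM h by (intro inj_onI) metis
      ultimately have "card (M c u) \<le> card (M c v - {d})"
        using card_M[OF c uv(2)] by (intro card_inj_on_le) auto
      moreover have "d \<in> M c v" using d d_ne by (simp add: M_def)
      then have "card (M c v - {d}) < card (M c v)"
        using card_M(1)[OF c uv(2)] by (rule card_Diff1_less[rotated])
      ultimately show False using card_M(2)[OF c] uv by simp
    qed
    then obtain a where a: "a \<in> M c u" and ua: "\<And>q. q \<in> M c v \<Longrightarrow> \<not> R u v a q" by blast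
    \<comment> \<open>Otherwise choosing partners injects \<open>M c v\<close> into
      \<open>M c u\<close>; as both have \<open>m - 1\<close> elements, the injection is onto and
      reaches the unmatched \<open>a\<close>.\<close>
    have "\<exists>b\<in>M c v. \<forall>p\<in>M c u. \<not> R u v p b"
    proof (rule ccontr)
      assume "\<not> ?thesis"
      then have "\<forall>b\<in>M c v. \<exists>p. p \<in> M c u \<and> R u v p b" by blast
      then obtain h where h: "\<forall>b\<in>M c v. h b \<in> M c u \<and> R u v (h b) b" by (rule bchoice[THEN exE])
      have "inj_on h (M c v)" using DM(4)[OF uv] h by (intro inj_onI) metis
      moreover have "h ` M c v \<subseteq> M c u" using h by blast
      ultimately have "h ` M c v = M c u"
        using card_M[OF c] uv by (simp add: card_image card_subset_eq)
      then obtain b where "b \<in> M c v" "a = h b" using a by blast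
      then show False using ua h by blast
    qed
    then obtain b where b: "b \<in> M c v" and ub: "\<And>p. p \<in> M c u \<Longrightarrow> \<not> R u v p b" by blast
    have gain: "dp_chrom V E (m - 1) + (m - 1 - card V) ^ (card V - 2) \<le> card (colorings V E (M c) R)"
      by (rule dp_chrom_add_edge_le[OF G mcM[OF c] uv(3) a b ua ub])
    \<comment> \<open>Only the summand of the moved colour \<open>c\<close> needs the gain; every
      other colour of \<open>w\<close> contributes at least
      \<open>dp_chrom V E (m - 1)\<close>.\<close>
    have "m * dp_chrom V E (m - 1) = (\<Sum>c\<in>L w. dp_chrom V E (m - 1))"
      using D(2)[OF wV'] by simp
    also have "\<dots> = dp_chrom V E (m - 1) + (\<Sum>c\<in>L w - {c}. dp_chrom V E (m - 1))"
      using c D(1)[OF wV'] by (subst sum.remove[of _ c]) auto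
    also have "\<dots> + (m - 1 - card V) ^ (card V - 2) \<le>
        card (colorings V E (M c) R) + (\<Sum>c\<in>L w - {c}. card (colorings V E (M c) R))"
    proof -
      have "(\<Sum>c\<in>L w - {c}. dp_chrom V E (m - 1)) \<le> (\<Sum>c\<in>L w - {c}. card (colorings V E (M c) R))"
        by (rule sum_mono) (use base in auto)
      then show ?thesis using gain by linarith
    qed
    also have "\<dots> = (\<Sum>c\<in>L w. card (colorings V E (M c) R))"
      using c D(1)[OF wV'] by (subst sum.remove[of _ c]) auto
    finally have "m * dp_chrom V E (m - 1) + (m - 1 - card V) ^ (card V - 2) \<le> dp_chrom V' E' m"
      using residual le by linarith
    moreover have "2 \<le> card V"
      using card_mono[OF finV, of "{u, v}"] uv simple_graph_no_loop[OF G uv(3)] by simp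
    ultimately show ?thesis by simp
  qed
qed

section \<open>Renaming of vertices\<close>

lemma bij_betw_colorings_image:
  fixes h :: "'u \<Rightarrow> 'v"
  assumes "inj h"
  shows "bij_betw (\<lambda>f. restrict (f \<circ> h) V) (colorings (h ` V) ((`) h ` E) L R)
    (colorings V E (L \<circ> h) (\<lambda>u v. R (h u) (h v)))"
proof -
  have E_iff: "{h u, h v} \<in> (`) h ` E \<longleftrightarrow> {u, v} \<in> E" for u v
  proof -
    have "{h u, h v} = h ` {u, v}" by simp
    then show ?thesis using inj_image_mem_iff[of "(`) h" "{u, v}" E] assms
      by (metis inj_image_eq_iff injI)
  qed
  have inv: "inv h (h v) = v" for v using assms by simp
  show ?thesis
  proof (rule bij_betw_byWitness[where f' = "\<lambda>g. restrict (g \<circ> inv h) (h ` V)"])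
    show "\<forall>f\<in>colorings (h ` V) ((`) h ` E) L R.
        restrict (restrict (f \<circ> h) V \<circ> inv h) (h ` V) = f"
    proof
      fix f assume f: "f \<in> colorings (h ` V) ((`) h ` E) L R"
      show "restrict (restrict (f \<circ> h) V \<circ> inv h) (h ` V) = f"
      proof
        fix x show "restrict (restrict (f \<circ> h) V \<circ> inv h) (h ` V) x = f x"
          using PiE_arb[OF coloringsD(1)[OF f], of x] by (cases "x \<in> h ` V") (auto simp: inv)
      qed
    qed
    show "\<forall>g\<in>colorings V E (L \<circ> h) (\<lambda>u v. R (h u) (h v)).
        restrict (restrict (g \<circ> inv h) (h ` V) \<circ> h) V = g"
    proof
      fix g assume g: "g \<in> colorings V E (L \<circ> h) (\<lambda>u v. R (h u) (h v))"
      show "restrict (restrict (g \<circ> inv h) (h ` V) \<circ> h) V = g"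
      proof
        fix x show "restrict (restrict (g \<circ> inv h) (h ` V) \<circ> h) V x = g x"
          using PiE_arb[OF coloringsD(1)[OF g], of x] by (cases "x \<in> V") (auto simp: inv)
      qed
    qed
    show "(\<lambda>f. restrict (f \<circ> h) V) ` colorings (h ` V) ((`) h ` E) L R
        \<subseteq> colorings V E (L \<circ> h) (\<lambda>u v. R (h u) (h v))"
    proof (rule image_subsetI)
      fix f assume f: "f \<in> colorings (h ` V) ((`) h ` E) L R"
      show "restrict (f \<circ> h) V \<in> colorings V E (L \<circ> h) (\<lambda>u v. R (h u) (h v))"
      proof (rule coloringsI)
        show "restrict (f \<circ> h) V \<in> PiE V (L \<circ> h)"
          using coloringsD(2)[OF f] by (simp add: restrict_PiE_iff)
      next
        fix u v assume "u \<in> V" "v \<in> V" "{u, v} \<in> E"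
          "R (h u) (h v) (restrict (f \<circ> h) V u) (restrict (f \<circ> h) V v)"
        then show False using coloringsD(3)[OF f, of "h u" "h v"] E_iff by simp
      qed
    qed
    show "(\<lambda>g. restrict (g \<circ> inv h) (h ` V)) ` colorings V E (L \<circ> h) (\<lambda>u v. R (h u) (h v))
        \<subseteq> colorings (h ` V) ((`) h ` E) L R"
    proof (rule image_subsetI)
      fix g assume g: "g \<in> colorings V E (L \<circ> h) (\<lambda>u v. R (h u) (h v))"
      show "restrict (g \<circ> inv h) (h ` V) \<in> colorings (h ` V) ((`) h ` E) L R"
      proof (rule coloringsI)
        show "restrict (g \<circ> inv h) (h ` V) \<in> PiE (h ` V) L"
          using coloringsD(2)[OF g] by (auto simp: restrict_PiE_iff inv)
      next
        fix x y assume "x \<in> h ` V" "y \<in> h ` V" and xy: "{x, y} \<in> (`) h ` E"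
          "R x y (restrict (g \<circ> inv h) (h ` V) x) (restrict (g \<circ> inv h) (h ` V) y)"
        then obtain u v where uv: "u \<in> V" "v \<in> V" "x = h u" "y = h v" by blast
        then show False using coloringsD(3)[OF g, of u v] xy E_iff by (simp add: inv)
      qed
    qed
  qed
qed

lemma chrom_image_eq:
  assumes "inj h"
  shows "chrom (h ` V) ((`) h ` E) m = chrom V E m"
  using bij_betw_same_card[OF bij_betw_colorings_image[OF assms, of V E "\<lambda>_. {0..<m}" "\<lambda>_ _. (=)"]]
  by (simp add: chrom_eq_card_colorings comp_def)

lemma simple_graph_image:
  assumes "simple_graph V E" "inj h"
  shows "simple_graph (h ` V) ((`) h ` E)"
  unfolding simple_graph_def
proof (intro conjI ballI)
  show "finite (h ` V)" using assms(1) by (simp add: simple_graph_def)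
  fix x assume "x \<in> (`) h ` E"
  then obtain e where e: "e \<in> E" "x = h ` e" by blast
  then obtain u v where "e = {u, v}" "u \<in> V" "v \<in> V" "u \<noteq> v"
    using assms(1) unfolding simple_graph_def by meson
  then have "x = {h u, h v}" "h u \<in> h ` V" "h v \<in> h ` V" "h u \<noteq> h v"
    using e assms(2) by (simp_all add: inj_eq)
  then show "\<exists>u v. x = {u, v} \<and> u \<in> h ` V \<and> v \<in> h ` V \<and> u \<noteq> v" by blast
qed

text \<open>\<open>dp_chrom\<close> minimises over covers whose vertex type depends on that of the
  graph, so passing from \<open>'a\<close> to \<open>'a + nat\<close> needs an argument: a
  minimising cover of the image pulls back along \<open>h\<close> with the same number of
  colourings.\<close>

lemma dp_chrom_le_dp_chrom_image:
  fixes h :: "'u \<Rightarrow> 'v"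
  assumes G: "simple_graph V E" and "inj h"
  shows "dp_chrom V E m \<le> dp_chrom (h ` V) ((`) h ` E) m"
proof -
  obtain L :: "'v \<Rightarrow> ('v \<times> nat) set" and R where mc: "matching_cover (h ` V) ((`) h ` E) m L R"
    and le: "card (colorings (h ` V) ((`) h ` E) L R) \<le> dp_chrom (h ` V) ((`) h ` E) m"
    using ex_matching_cover_le_dp_chrom[OF simple_graph_image[OF assms], of m] by (elim exE conjE)
  note D = matching_coverD[OF mc]
  have E: "{h u, h v} \<in> (`) h ` E" if "{u, v} \<in> E" for u v
    using imageI[OF that, of "(`) h"] by simp
  have "matching_cover V E m (L \<circ> h) (\<lambda>u v. R (h u) (h v))"
    unfolding matching_cover_def
  proof (intro conjI ballI impI)
    fix u v c d assume "u \<in> V" "v \<in> V" "{u, v} \<in> E" "c \<in> (L \<circ> h) u" "d \<in> (L \<circ> h) v" "R (h u) (h v) c d"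
    then show "R (h v) (h u) d c" using D(3)[of "h u" "h v" c d] E by simp
  next
    fix u v c d d' assume "u \<in> V" "v \<in> V" "{u, v} \<in> E" "c \<in> (L \<circ> h) u" "d \<in> (L \<circ> h) v"
      "d' \<in> (L \<circ> h) v" "R (h u) (h v) c d" "R (h u) (h v) c d'"
    then show "d = d'" using D(4)[of "h u" "h v" c d d'] E by simp
  qed (use D in simp_all)
  from dp_chrom_le[OF G this] show ?thesis
    using le bij_betw_same_card[OF bij_betw_colorings_image[OF assms(2), of V E L R]] by simp
qed

section \<open>Decrease of the deficit constant\<close>

text \<open>Divided by \<open>real m powr (real n - 2)\<close>, the left side tends to
  \<open>C - 1\<close>, so it is eventually below \<open>C - 1/2\<close>; the spare half absorbs the
  lower order terms. Real powers appear because \<open>n - 3\<close> is negative for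
  \<open>n = 2\<close>.\<close>

lemma eventually_cone_main_term_le:
  fixes C :: real and n k :: nat
  assumes "n = k + 2"
  shows "\<forall>\<^sub>F m in sequentially. real m * (C * real (m - 1) powr (real n - 3)) - real ((m - 1 - n) ^ k)
           \<le> (C - 1/2) * real m powr (real n - 2)"
proof -
  have ratio: "(\<lambda>m. (real m - a) / real m) \<longlonglongrightarrow> 1" for a
  proof (rule Lim_transform_eventually)
    have "(\<lambda>m. 1 - a / real m) \<longlonglongrightarrow> 1 - 0"
      by (intro tendsto_diff tendsto_const lim_const_over_n)
    then show "(\<lambda>m. 1 - a / real m) \<longlonglongrightarrow> 1" by simp
    show "\<forall>\<^sub>F m in sequentially. 1 - a / real m = (real m - a) / real m"
      using eventually_gt_at_top[of 0] by eventually_elim (simp add: diff_divide_distrib)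
  qed
  have "(\<lambda>m. C * ((real m - 1) / real m) powr (real n - 3) - ((real m - (1 + real n)) / real m) ^ k)
      \<longlonglongrightarrow> C * 1 powr (real n - 3) - 1 ^ k"
    by (intro tendsto_diff tendsto_mult tendsto_const tendsto_powr tendsto_power ratio) simp
  then have lim: "(\<lambda>m. C * ((real m - 1) / real m) powr (real n - 3) - ((real m - 1 - real n) / real m) ^ k)
      \<longlonglongrightarrow> C - 1" by (simp add: diff_diff_eq)
  have "\<forall>\<^sub>F m in sequentially. C * ((real m - 1) / real m) powr (real n - 3) -
      ((real m - 1 - real n) / real m) ^ k < C - 1/2"
    by (rule order_tendstoD(2)[OF lim]) simp
  then show ?thesis
    \<comment> \<open>For \<open>m > n + 1\<close> the truncated subtractions agree with those of
      real numbers.\<close>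
    using eventually_gt_at_top[of "n + 1"]
  proof eventually_elim
    case (elim m)
    define x where "x = real m"
    have x: "x > 1" "real (m - 1) = x - 1" "real (m - 1 - n) = x - 1 - real n"
      using elim(2) by (auto simp: x_def of_nat_diff)
    have "x * (C * (x - 1) powr (real n - 3)) = C * ((x - 1) / x) powr (real n - 3) * x powr (real n - 2)"
    proof -
      have "x powr (real n - 2) = x * x powr (real n - 3)"
        using x powr_add[of x 1 "real n - 3"] by simp
      then show ?thesis using x by (simp add: powr_divide)
    qed
    moreover have "(x - 1 - real n) ^ k = ((x - 1 - real n) / x) ^ k * x powr (real n - 2)"
      using x assms by (simp add: power_divide powr_realpow)
    ultimately have "real m * (C * real (m - 1) powr (real n - 3)) - real ((m - 1 - n) ^ k) =
        (C * ((x - 1) / x) powr (real n - 3) - ((x - 1 - real n) / x) ^ k) * x powr (real n - 2)"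
      using x by (simp add: x_def algebra_simps)
    also have "\<dots> \<le> (C - 1/2) * x powr (real n - 2)"
      using elim(1) by (intro mult_right_mono) (auto simp: x_def)
    finally show ?case by (simp add: x_def)
  qed
qed

text \<open>Subtracting the two cone bounds leaves \<open>m\<close> times the deficit of
  \<open>G\<close> at \<open>m - 1\<close>, minus the gain. The maximum with \<open>0\<close>
  accounts for the alternative without deficit, since \<open>C - 1/2\<close> may be
  negative.\<close>

lemma deficit_cone:
  fixes V :: "'v set" and C :: real
  assumes G: "simple_graph V E" and w: "w \<notin> V"
  defines "V' \<equiv> insert w V" and "E' \<equiv> E \<union> {{w, v} | v. v \<in> V}"
  assumes bound: "\<forall>\<^sub>F m in sequentially.
    real (chrom V E m) - real (dp_chrom V E m) \<le> C * real m powr (real (card V) - 3)"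
  shows "\<forall>\<^sub>F m in sequentially. real (chrom V' E' m) - real (dp_chrom V' E' m)
    \<le> max 0 (C - 1/2) * real m powr (real (card V') - 3)"
proof (cases "2 \<le> card V")
  case False
  have le: "chrom V' E' m \<le> dp_chrom V' E' m" for m
    using dp_chrom_cone_ge[OF G w, of m] False by (simp add: V'_def E'_def)
  show ?thesis
  proof (intro always_eventually allI)
    fix m
    have "0 \<le> max 0 (C - 1/2) * real m powr (real (card V') - 3)" by simp
    then show "real (chrom V' E' m) - real (dp_chrom V' E' m)
        \<le> max 0 (C - 1/2) * real m powr (real (card V') - 3)"
      using le[of m] by linarith
  qed
next
  case True
  define n where "n = card V"
  \<comment> \<open>The cone has \<open>n + 1\<close> vertices, so its exponent is one larger, in
    step with the factor \<open>m\<close>.\<close>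
  have card': "real (card V') - 3 = real n - 2"
    using G w by (simp add: V'_def n_def simple_graph_def)
  have n: "n = (n - 2) + 2" using True by (simp add: n_def)
  \<comment> \<open>The bound for \<open>G\<close> is applied at \<open>m - 1\<close>, the list size
    left once the apex is coloured.\<close>
  have "filterlim (\<lambda>m. m - 1) at_top (sequentially :: nat filter)"
    by (rule filterlim_minus_const_nat_at_top)
  with bound have "\<forall>\<^sub>F m in sequentially.
      real (chrom V E (m - 1)) - real (dp_chrom V E (m - 1)) \<le> C * real (m - 1) powr (real n - 3)"
    unfolding n_def by (rule eventually_compose_filterlim)
  then show ?thesis
    using eventually_cone_main_term_le[OF n, of C]
  proof eventually_elim
    case (elim m)
    have "chrom V' E' m \<le> dp_chrom V' E' m \<or>
        m * dp_chrom V E (m - 1) + (m - 1 - n) ^ (n - 2) \<le> dp_chrom V' E' m"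
      using dp_chrom_cone_ge[OF G w, of m] unfolding V'_def E'_def n_def by blast
    then show ?case
    proof
      assume "chrom V' E' m \<le> dp_chrom V' E' m"
      moreover have "0 \<le> max 0 (C - 1/2) * real m powr (real (card V') - 3)" by simp
      ultimately show ?thesis by linarith
    next
      assume "m * dp_chrom V E (m - 1) + (m - 1 - n) ^ (n - 2) \<le> dp_chrom V' E' m"
      then have "real m * real (dp_chrom V E (m - 1)) + real ((m - 1 - n) ^ (n - 2)) \<le> real (dp_chrom V' E' m)"
        by (simp only: flip: of_nat_mult of_nat_add)
      moreover have "real (chrom V' E' m) \<le> real m * real (chrom V E (m - 1))"
        using of_nat_mono[OF chrom_cone_le[OF G w, of m], where 'a = real]
        unfolding V'_def E'_def of_nat_mult .
      moreover have "real m * (real (chrom V E (m - 1)) - real (dp_chrom V E (m - 1)))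
          \<le> real m * (C * real (m - 1) powr (real n - 3))"
        using elim(1) by (rule mult_left_mono) simp
      moreover have "(C - 1/2) * real m powr (real n - 2) \<le> max 0 (C - 1/2) * real m powr (real n - 2)"
        by (rule mult_right_mono) auto
      ultimately show ?thesis using elim(2) unfolding card' by (simp add: right_diff_distrib)
    qed
  qed
qed

section \<open>The join as an iterated cone\<close>

lemma join_K_0: "join_K_V V 0 = Inl ` V" "join_K_E V E 0 = (`) Inl ` E"
  by (auto simp: join_K_V_def join_K_E_def)

text \<open>Building the join one apex at a time lets the cone step be iterated.\<close>

lemma join_K_Suc:
  fixes V :: "'a set"
  shows "join_K_V V (Suc p) = insert (Inr p) (join_K_V V p)"
  and "join_K_E V E (Suc p) = join_K_E V E p \<union> {{Inr p, x} | x. x \<in> join_K_V V p}"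
proof -
  show "join_K_V V (Suc p) = insert (Inr p) (join_K_V V p)"
    by (auto simp: join_K_V_def)
  have "{{Inr i, Inr j} | i j. i < Suc p \<and> j < Suc p \<and> i \<noteq> j} =
      ({{Inr i, Inr j} | i j. i < p \<and> j < p \<and> i \<noteq> j} \<union> {{Inr p, Inr j} | j. j < p} :: ('a + nat) set set)"
    by (auto simp: less_Suc_eq insert_commute)
  moreover have "{{Inl v, Inr i} | v i. v \<in> V \<and> i < Suc p} =
      {{Inl v, Inr i} | v i. v \<in> V \<and> i < p} \<union> {{Inr p, Inl v} | v. v \<in> V}"
    by (auto simp: less_Suc_eq insert_commute)
  moreover have "{{Inr p, x} | x. x \<in> join_K_V V p} =
      {{Inr p, Inr j} | j. j < p} \<union> {{Inr p, Inl v} | v. v \<in> V}"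
    by (auto simp: join_K_V_def)
  ultimately show "join_K_E V E (Suc p) = join_K_E V E p \<union> {{Inr p, x} | x. x \<in> join_K_V V p}"
    unfolding join_K_E_def by (simp add: Un_ac)
qed

lemma Inr_notin_join_K_V: "Inr p \<notin> join_K_V V p"
  by (auto simp: join_K_V_def)

lemma simple_graph_join_K:
  assumes "simple_graph V E"
  shows "simple_graph (join_K_V V p) (join_K_E V E p)"
proof (induction p)
  case 0
  then show ?case unfolding join_K_0 using assms inj_Inl by (rule simple_graph_image)
next
  case (Suc p)
  then show ?case unfolding join_K_Suc using Inr_notin_join_K_V by (rule simple_graph_cone)
qed

theorem mainTheorem7:
  fixes V :: "'a set" and E :: "'a set set"
  assumes "simple_graph V E"
    and "(\<lambda>m. real (chrom V E m) - real (dp_chrom V E m)) \<in> O(\<lambda>m. real m powr (real (card V) - 3))"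
  shows "\<exists>p N. \<forall>m::nat. m \<ge> N \<longrightarrow>
           dp_chrom (join_K_V V p) (join_K_E V E p) m = chrom (join_K_V V p) (join_K_E V E p) m"
proof -
  let ?V = "join_K_V V" and ?E = "join_K_E V E"
  obtain C where C: "\<forall>\<^sub>F m in sequentially. norm (real (chrom V E m) - real (dp_chrom V E m))
      \<le> C * norm (real m powr (real (card V) - 3))"
    using landau_o.bigE[OF assms(2)] by blast
  have deficit: "\<forall>\<^sub>F m in sequentially. real (chrom (?V p) (?E p) m) - real (dp_chrom (?V p) (?E p) m)
      \<le> max 0 (C - real p / 2) * real m powr (real (card (?V p)) - 3)" for p
  proof (induction p)
    case 0
    \<comment> \<open>The join with \<open>K_0\<close> is the copy of \<open>G\<close> under
      \<open>Inl\<close>; copying preserves \<open>chrom\<close> and does not lower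
      \<open>dp_chrom\<close>.\<close>
    have card_eq: "card (Inl ` V :: ('a + nat) set) = card V" by (simp add: card_image)
    show ?case
      using C
    proof eventually_elim
      case (elim m)
      have "real (dp_chrom V E m) \<le> real (dp_chrom (?V 0) (?E 0) m)"
        unfolding join_K_0 using dp_chrom_le_dp_chrom_image[OF assms(1) inj_Inl] by simp
      moreover have "chrom (?V 0) (?E 0) m = chrom V E m"
        unfolding join_K_0 using inj_Inl by (rule chrom_image_eq)
      moreover have "C * real m powr (real (card V) - 3) \<le> max 0 C * real m powr (real (card V) - 3)"
        by (rule mult_right_mono) auto
      ultimately show ?case using elim unfolding join_K_0 card_eq by simp
    qed
  next
    case (Suc p)
    \<comment> \<open>Once the constant has reached \<open>0\<close> it stays there, so the
      truncations of successive steps merge into one.\<close>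
    have "max 0 (max 0 (C - real p / 2) - 1/2) = max 0 (C - real (Suc p) / 2)"
      by (simp add: field_simps max_def)
    then show ?case
      using deficit_cone[OF simple_graph_join_K[OF assms(1)] Inr_notin_join_K_V Suc]
      unfolding join_K_Suc by simp
  qed
  obtain p :: nat where "2 * C \<le> real p" using real_arch_simple by blast
  then have "max 0 (C - real p / 2) = 0" by simp
  then have "\<forall>\<^sub>F m in sequentially. real (chrom (?V p) (?E p) m) - real (dp_chrom (?V p) (?E p) m) \<le> 0"
    using deficit[of p] by simp
  \<comment> \<open>The inequality \<open>dp_chrom \<le> chrom\<close> always holds, so a deficit
    that is at most zero vanishes.\<close>
  then have "\<forall>\<^sub>F m in sequentially. dp_chrom (?V p) (?E p) m = chrom (?V p) (?E p) m"
  proof eventually_elim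
    case (elim m)
    then show ?case using dp_chrom_le_chrom[OF simple_graph_join_K[OF assms(1)], of p m] by simp
  qed
  then show ?thesis unfolding eventually_sequentially by blast
qed

end
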